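(* Let $\ell\ge1$ be an integer with $\ell\le\min(m,n)$, and let $A,B\in\mathbb{R}^{m\times n}$ be matrices of the same dimensions obeying $\sigma(B)\le\sigma(A)$. Then $$\sigma\bigl(B_{(\ell)}\bigr)\;\le_d\;\sigma\bigl(A_{(\ell)}\bigr).$$
   Context: For $A\in\mathbb{R}^{m\times n}$, $\sigma(A)\in\mathbb{R}^{\min(m,n)}$ is the vector of singular values of $A$ in non-increasing order; inequalities between vectors are entrywise. For a matrix $G$ with $n$ rows, $f(A,G):=(I-P)A$ where $P$ is the orthogonal projector onto the range (column space) of $AG$. When $G$ is an $n\times\ell$ random matrix with i.i.d. $\mathcal{N}(0,1)$ entries, $A_{(\ell)}$ denotes the random matrix $f(A,G)$. For random vectors $z_1,z_2$ in $\mathbb{R}^d$, $z_2\le_d z_1$ (equivalently $z_1\ge_d z_2$) means $\mathbb{P}(z_1\ge x)\ge\mathbb{P}(z_2\ge x)$ for all $x\in\mathbb{R}^d$. *)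

theory Defs
  imports "HOL-Probability.Probability" "HOL-Computational_Algebra.Polynomial"
begin

(* A matrix in R^(m x n) is a term of type real^'n^'m, with CARD('m) = m and CARD('n) = n. *)

(* det (x I - M) as a polynomial in x *)
definition charpoly :: "real^'n^'n \<Rightarrow> real poly" where
  "charpoly M = det (\<chi> i j. [: - M $ i $ j, if i = j then 1 else 0 :])"

(* The square roots of the eigenvalues of A^T A, repeated according to multiplicity, in
   non-increasing order.  A^T A is symmetric, so its n eigenvalues are real and all of them occur
   in proots.  If n > m, the last n - m of them vanish and are dropped. *)
definition singular_values :: "real^'n^'m \<Rightarrow> real list" where
  "singular_values A =
     take (min CARD('m) CARD('n))
       (rev (sorted_list_of_multiset (image_mset sqrt (proots (charpoly (transpose A ** A))))))"

(* Vectors in R^d with d = min(m,n) are lists of length d; the entrywise order is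
   list_all2 (\<le>), which includes equality of lengths. *)
abbreviation entrywise_le :: "real list \<Rightarrow> real list \<Rightarrow> bool" where
  "entrywise_le x y \<equiv> list_all2 (\<le>) x y"

definition orth_projector :: "(real^'m) set \<Rightarrow> real^'m^'m" where
  "orth_projector S = (THE P. P ** P = P \<and> transpose P = P \<and> range ((*v) P) = S)"

definition residual :: "real^'n^'m \<Rightarrow> real^'l^'n \<Rightarrow> real^'n^'m" where
  "residual A G = (mat 1 - orth_projector (range ((*v) (A ** G)))) ** A"

definition std_gaussian_matrix :: "'w measure \<Rightarrow> ('w \<Rightarrow> real^'l^'n) \<Rightarrow> bool" where
  "std_gaussian_matrix M G \<longleftrightarrow>
     prob_space.indep_vars M (\<lambda>_. borel) (\<lambda>(i, j) \<omega>. G \<omega> $ i $ j) UNIV \<and>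
     (\<forall>i j. distributed M lborel (\<lambda>\<omega>. G \<omega> $ i $ j) std_normal_density)"

(* z2 \<le>_d z1 for random vectors z2, z1 in R^d; being a relation between laws, it does not
   require z2 and z1 to live on the same probability space. *)
definition dist_le ::
  "nat \<Rightarrow> 'v measure \<Rightarrow> ('v \<Rightarrow> real list) \<Rightarrow> 'w measure \<Rightarrow> ('w \<Rightarrow> real list) \<Rightarrow> bool" where
  "dist_le d M2 z2 M1 z1 \<longleftrightarrow>
     (\<forall>x. length x = d \<longrightarrow>
        measure M1 {\<omega> \<in> space M1. entrywise_le x (z1 \<omega>)}
          \<ge> measure M2 {\<omega> \<in> space M2. entrywise_le x (z2 \<omega>)})"

lemma projector_unique:
  fixes P Q :: "real^'m^'m"
  assumes "P ** P = P" "transpose P = P" "Q ** Q = Q" "transpose Q = Q"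
    and "range ((*v) P) = range ((*v) Q)"
  shows "P = Q"
proof -
  have absorb: "X ** Y = Y"
    if idem: "X ** X = X" and sub: "range ((*v) Y) \<subseteq> range ((*v) X)" for X Y :: "real^'m^'m"
  proof -
    have "(X ** Y) *v v = Y *v v" for v
    proof -
      obtain w where "Y *v v = X *v w" using sub by blast
      then show ?thesis using idem by (metis matrix_vector_mul_assoc)
    qed
    then show ?thesis by (simp add: matrix_eq)
  qed
  have PQ: "P ** Q = Q" and QP: "Q ** P = P" using assms absorb by auto
  have "transpose (P ** Q) = Q ** P" by (simp add: matrix_transpose_mul assms)
  then show ?thesis using PQ QP assms by simp
qed

(* orth_projector is well defined *)
lemma orth_projector_ex1:
  fixes S :: "(real^'m) set"
  assumes "subspace S"
  shows "\<exists>!P::real^'m^'m. P ** P = P \<and> transpose P = P \<and> range ((*v) P) = S"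
proof -
  obtain B where B: "B \<subseteq> S" "pairwise orthogonal B" "\<And>x. x \<in> B \<Longrightarrow> norm x = 1"
    "independent B" "span B = S"
    using orthonormal_basis_subspace[OF assms] by metis
  have fin: "finite B" using B(4) by (simp add: independent_bound)
  define p where "p x = (\<Sum>b\<in>B. (b \<bullet> x) *\<^sub>R b)" for x :: "real^'m"
  have lin: "linear p"
    unfolding p_def by (intro linearI)
      (simp_all add: inner_add_right scaleR_add_left sum.distrib scaleR_sum_right)
  have inS: "p x \<in> S" for x
    unfolding p_def using B(1) assms by (auto intro!: subspace_sum subspace_scale)
  have pb: "p b = b" if "b \<in> B" for b
  proof -
    have "p b = (\<Sum>c\<in>B. if c = b then b else 0)"
      unfolding p_def using that B(2,3)
      by (intro sum.cong) (auto simp: pairwise_def orthogonal_def norm_eq_1)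
    then show ?thesis using that fin by simp
  qed
  have pS: "p x = x" if "x \<in> S" for x
    using linear_eq_on_span[OF lin linear_id, of B x] pb that B(5) by auto
  have sym: "p x \<bullet> y = x \<bullet> p y" for x y
    unfolding p_def by (simp add: inner_sum_left inner_sum_right inner_commute mult.commute)
  have mp: "matrix p *v x = p x" for x using matrix_works[of p x] lin by simp
  have "matrix p ** matrix p = matrix p"
    by (simp add: matrix_eq flip: matrix_vector_mul_assoc) (simp add: mp pS inS)
  moreover have "transpose (matrix p) = matrix p"
  proof -
    have "adjoint p = p" by (rule adjoint_unique) (simp add: sym)
    then show ?thesis using matrix_adjoint[OF lin] by simp
  qed
  moreover have "range ((*v) (matrix p)) = S"
  proof -
    have "x \<in> range p" if "x \<in> S" for x using pS[OF that] by (metis rangeI)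
    then show ?thesis using inS by (auto simp: mp)
  qed
  ultimately show ?thesis using projector_unique by (intro ex1I[of _ "matrix p"]) auto
qed

end

(*
  By the spectral theorem for A^T A and B^T B, the hypothesis sigma(B) <= sigma(A) provides an
  orthogonal V with |B x| <= |A V x| for all x.  Since |f(A,G) x| is the distance from A x to the
  range of A G, that is, the minimum over z of |A (x - G z)|, this yields
  |f(B,G) x| <= |f(A, V G) V x|, and Courant-Fischer gives sigma(f(B,G)) <= sigma(f(A, V G)) for
  every single G.  Finally V G has the same law as G.  The events involved are Borel because
  {M. t <= sigma_i(M)} is closed and G |-> f(A,G) is Borel measurable.
*)

theory Submission
  imports Defs
begin

section \<open>Singular values\<close>

text \<open>Coupling with one and the same G on both sides would fail, even for equal singular
  values: with A = diag(2,1), B = diag(1,2) and G = e_1 the residuals diag(0,1) and diag(0,2) are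
  ordered the wrong way. V aligns the right singular vectors of B with those of A; the left ones
  need no matching, since only norms of images are compared. Courant-Fischer serves as a threshold
  test: t \<le> sigma_i(M), with i counted from 0, iff |M x| \<ge> t |x| on some subspace of
  dimension above i. This one form gives both monotonicity and closedness. Likewise, a strict upper
  bound on a residual norm is expressed by the existence of a z, which gives the comparison of
  residuals and also their measurability, although the projector can jump where the rank of A G
  drops.\<close>

text \<open>First-order condition at a maximum. With \<open>w = f u - c *\<^sub>R u\<close>, moving
  from \<open>u\<close> to \<open>u + t *\<^sub>R w\<close> raises
  \<open>x \<bullet> f x - c * (x \<bullet> x)\<close> by 2 t |w|^2 up to a term of order t^2, so a
  nonzero \<open>w\<close> would break the bound for small positive \<open>t\<close>.\<close>

lemma selfadjoint_maximizer_eigenvector: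
  fixes f :: "'a::euclidean_space \<Rightarrow> 'a"
  assumes "linear f" and sym: "\<And>x y. f x \<bullet> y = x \<bullet> f y"
    and W: "subspace W" and inv: "\<And>x. x \<in> W \<Longrightarrow> f x \<in> W"
    and u: "u \<in> W" "u \<bullet> f u = c * (u \<bullet> u)"
    and max: "\<And>x. x \<in> W \<Longrightarrow> x \<bullet> f x \<le> c * (x \<bullet> x)"
  shows "f u = c *\<^sub>R u"
proof -
  interpret f: linear f by fact
  define w where "w = f u - c *\<^sub>R u"
  define a where "a = w \<bullet> w"
  define b where "b = c * (w \<bullet> w) - w \<bullet> f w"
  have w: "w \<in> W"
    unfolding w_def using W u inv by (intro subspace_diff subspace_scale)
  have quad: "2 * t * a \<le> t\<^sup>2 * b" for t
  proof -
    have "u + t *\<^sub>R w \<in> W"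
      using W u w by (intro subspace_add subspace_scale)
    from max[OF this] have
      "u \<bullet> f u + t * (u \<bullet> f w) + t * (w \<bullet> f u) + t\<^sup>2 * (w \<bullet> f w)
        \<le> c * (u \<bullet> u) + 2 * t * (c * (u \<bullet> w)) + t\<^sup>2 * (c * (w \<bullet> w))"
      by (simp add: f.add f.scale inner_simps power2_eq_square algebra_simps inner_commute)
    moreover have "u \<bullet> f w = w \<bullet> f u" using sym[of u w] by (simp add: inner_commute)
    moreover have "w \<bullet> f u = a + c * (u \<bullet> w)"
      unfolding a_def by (subst (2) w_def) (simp add: inner_simps inner_commute)
    ultimately show ?thesis using u(2) unfolding b_def by (simp add: algebra_simps)
  qed
  have "a \<le> 0"
  proof (rule ccontr)
    assume "\<not> a \<le> 0"
    then have a: "a > 0" by simp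
    \<comment> \<open>Small enough for the linear term to win:
      \<open>t * (\<bar>b\<bar> + 1)\<close> equals \<open>a\<close>, against the
      \<open>2 * a\<close> demanded. The 1 keeps the denominator positive when
      \<open>b = 0\<close>.\<close>
    define t where "t = a / (\<bar>b\<bar> + 1)"
    have t: "t > 0" using a by (simp add: t_def)
    have "2 * t * a \<le> t * (t * b)" using quad[of t] by (simp add: power2_eq_square)
    then have "2 * a \<le> t * b" using t by (simp add: mult.assoc)
    also have "\<dots> \<le> t * (\<bar>b\<bar> + 1)" using t by (intro mult_left_mono) auto
    also have "\<dots> = a" by (simp add: t_def)
    finally show False using a by simp
  qed
  then have "w = 0" unfolding a_def by (metis inner_ge_zero inner_eq_zero_iff order_antisym)
  then show ?thesis by (simp add: w_def)
qed

text \<open>Induction inside a fixed type, on the dimension of an invariant subspace: a maximizer of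
  the quadratic form on the unit sphere of \<open>W\<close> is an eigenvector, and by symmetry its
  orthogonal complement in \<open>W\<close> is again invariant. Taking a maximizer at each stage
  puts the eigenvalues in non-increasing order.\<close>

lemma selfadjoint_eigenbasis:
  fixes f :: "'a::euclidean_space \<Rightarrow> 'a"
  assumes lin: "linear f" and sym: "\<And>x y. f x \<bullet> y = x \<bullet> f y"
    and "subspace W" "\<And>x. x \<in> W \<Longrightarrow> f x \<in> W"
  shows "\<exists>u c. (\<forall>i<dim W. u i \<in> W \<and> f (u i) = c i *\<^sub>R u i) \<and>
           (\<forall>i<dim W. \<forall>j<dim W. u i \<bullet> u j = (if i = j then 1 else 0)) \<and>
           (\<forall>i<dim W. \<forall>j<dim W. i \<le> j \<longrightarrow> c j \<le> (c i :: real))"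
  using assms(3,4)
proof (induction "dim W" arbitrary: W)
  case 0
  show ?case by (simp add: 0(1)[symmetric])
next
  case (Suc k)
  interpret f: linear f by fact
  let ?K = "W \<inter> sphere 0 1"
  have "compact ?K"
    using closed_subspace[OF Suc.prems(1)] by (intro closed_Int_compact) auto
  moreover have "?K \<noteq> {}"
  proof -
    have "\<not> W \<subseteq> {0}" using Suc.hyps(2) dim_eq_0[of W] by force
    then obtain x where "x \<in> W" "x \<noteq> 0" by blast
    then have "x /\<^sub>R norm x \<in> ?K"
      using Suc.prems(1) by (auto intro: subspace_scale)
    then show ?thesis by blast
  qed
  moreover have "continuous_on ?K (\<lambda>x. x \<bullet> f x)"
    using lin by (intro continuous_intros linear_continuous_on linear_linear[THEN iffD2])
  ultimately obtain u0 where u0: "u0 \<in> ?K" and u0_max: "\<And>x. x \<in> ?K \<Longrightarrow> x \<bullet> f x \<le> u0 \<bullet> f u0"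
    using continuous_attains_sup by (metis (no_types, lifting))
  define c0 where "c0 = u0 \<bullet> f u0"
  have norm_u0: "u0 \<bullet> u0 = 1" using u0 by (simp add: norm_eq_1)
  have max: "x \<bullet> f x \<le> c0 * (x \<bullet> x)" if "x \<in> W" for x
  proof (cases "x = 0")
    case False
    then have "x /\<^sub>R norm x \<in> ?K" using Suc.prems(1) that by (auto intro: subspace_scale)
    from u0_max[OF this] have "(x \<bullet> f x) / (norm x)\<^sup>2 \<le> c0"
      by (simp add: f.scale c0_def power2_eq_square field_simps)
    then show ?thesis using False by (simp add: field_simps power2_norm_eq_inner)
  qed (simp add: f.zero)
  have eig: "f u0 = c0 *\<^sub>R u0"
    using selfadjoint_maximizer_eigenvector[OF lin sym Suc.prems(1,2), of u0 c0] u0 norm_u0 max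
    by (auto simp: c0_def)
  define W' where "W' = W \<inter> {x. u0 \<bullet> x = 0}"
  have sub: "subspace W'"
    unfolding W'_def using Suc.prems(1) by (intro subspace_inter subspace_hyperplane)
  have inv: "f x \<in> W'" if "x \<in> W'" for x
    using that Suc.prems(2) sym[of u0 x] eig by (auto simp: W'_def)
  have dim_W': "dim W' = k"
  proof -
    have "dim ({y. \<forall>x\<in>span {u0}. orthogonal x y} \<inter> W) + dim (span {u0}) = dim W"
      using dim_subspace_orthogonal_to_vectors[of "span {u0}" W] Suc.prems(1) u0
      by (simp add: span_minimal Int_commute Collect_conj_eq)
    moreover have "{y. \<forall>x\<in>span {u0}. orthogonal x y} \<inter> W = W'"
      by (auto simp: W'_def orthogonal_def span_singleton)
    moreover have "dim (span {u0}) = 1"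
    proof -
      have "u0 \<noteq> 0" using norm_u0 by auto
      then have "independent {u0}" by simp
      from indep_card_eq_dim_span[OF this] show ?thesis by simp
    qed
    ultimately show ?thesis using Suc.hyps(2) by simp
  qed
  obtain u c where uc: "\<forall>i<k. u i \<in> W' \<and> f (u i) = c i *\<^sub>R u i"
    "\<forall>i<k. \<forall>j<k. u i \<bullet> u j = (if i = j then 1 else 0)"
    "\<forall>i<k. \<forall>j<k. i \<le> j \<longrightarrow> c j \<le> (c i :: real)"
    using Suc.hyps(1)[OF _ sub inv] dim_W' by auto
  have c_le: "c i \<le> c0" if "i < k" for i
    using max[of "u i"] uc that by (auto simp: W'_def)
  have on: "u i \<bullet> u i = 1" "u i \<bullet> u j \<noteq> 0 \<Longrightarrow> i = j" if "i < k" "j < k" for i j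
    using uc(2) that by (auto split: if_splits)
  show ?case
    using uc(1,3) on u0 eig norm_u0 c_le
    by (intro exI[of _ "case_nat u0 u"] exI[of _ "case_nat c0 c"])
       (auto simp: Suc.hyps(2)[symmetric] less_Suc_eq_0_disj W'_def inner_commute)
qed

lemma dim_span_orthonormal:
  fixes u :: "nat \<Rightarrow> 'a::euclidean_space"
  assumes on: "\<And>i j. i \<in> I \<Longrightarrow> j \<in> I \<Longrightarrow> u i \<bullet> u j = (if i = j then 1 else 0)"
  shows "dim (span (u ` I)) = card I"
proof -
  have inj: "inj_on u I"
    using on by (intro inj_onI) (metis zero_neq_one)
  have ind: "independent (u ` I)"
  proof (rule pairwise_orthogonal_independent)
    show "pairwise orthogonal (u ` I)"
      using on by (auto simp: pairwise_def orthogonal_def)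
    show "0 \<notin> u ` I" using on by force
  qed
  show "dim (span (u ` I)) = card I"
    using indep_card_eq_dim_span[OF ind] inj by (simp add: card_image)
qed

lemma orthonormal_expansion:
  fixes u :: "nat \<Rightarrow> 'a::euclidean_space"
  assumes on: "\<And>i j. i < DIM('a) \<Longrightarrow> j < DIM('a) \<Longrightarrow> u i \<bullet> u j = (if i = j then 1 else 0)"
  shows "x = (\<Sum>i<DIM('a). (u i \<bullet> x) *\<^sub>R u i)"
proof -
  define y where "y = x - (\<Sum>i<DIM('a). (u i \<bullet> x) *\<^sub>R u i)"
  have "orthogonal y v" if "v \<in> u ` {..<DIM('a)}" for v
  proof -
    obtain j where j: "j < DIM('a)" "v = u j" using \<open>v \<in> u ` {..<DIM('a)}\<close> by auto
    have "(\<Sum>i<DIM('a). (u i \<bullet> x) *\<^sub>R u i) \<bullet> u j = (\<Sum>i<DIM('a). if i = j then u j \<bullet> x else 0)"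
      unfolding inner_sum_left using j on by (intro sum.cong) auto
    then show ?thesis
      using j by (simp add: y_def orthogonal_def inner_diff_left inner_commute[of x])
  qed
  moreover have "span (u ` {..<DIM('a)}) = UNIV"
    using dim_span_orthonormal[of "{..<DIM('a)}" u] on
    by (metis lessThan_iff card_lessThan dim_eq_full span_span)
  ultimately have "orthogonal y y"
    by (metis UNIV_I orthogonal_to_span)
  then have "y = 0" by (simp add: orthogonal_def)
  then show ?thesis by (simp add: y_def)
qed

lemma orthonormal_norm_sum:
  fixes n :: nat
  assumes on: "\<And>i j. i < n \<Longrightarrow> j < n \<Longrightarrow> u i \<bullet> u j = (if i = j then 1 else (0::real))"
  shows "(norm (\<Sum>i<n. a i *\<^sub>R (u i :: 'a::real_inner)))\<^sup>2 = (\<Sum>i<n. (a i)\<^sup>2)"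
proof -
  have "(\<Sum>i<n. a i *\<^sub>R u i) \<bullet> (\<Sum>i<n. a i *\<^sub>R u i) = (\<Sum>i<n. \<Sum>j<n. if i = j then a i * a j else 0)"
    unfolding inner_sum_left inner_sum_right using on by (intro sum.cong) auto
  also have "\<dots> = (\<Sum>i<n. (a i)\<^sup>2)"
    by (intro sum.cong) (auto simp: power2_eq_square)
  finally show ?thesis by (simp only: power2_norm_eq_inner)
qed

section \<open>Eigenvalues as roots of the characteristic polynomial\<close>

lemma sum_linear_poly: "(\<Sum>k\<in>S. [:f k, g k:]) = [:\<Sum>k\<in>S. f k, \<Sum>k\<in>S. g k:]"
  by (induction S rule: infinite_finite_induct) auto

text \<open>The relation \<open>K ** Q = Q ** D\<close> lifts to (x I - K) Q = Q (x I - D) over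
  polynomials, where \<open>c\<close> embeds constants and \<open>p\<close> forms x I - A. After
  taking determinants, \<open>det (c Q)\<close> cancels: real polynomials form an integral domain,
  and the left inverse \<open>R\<close> makes this factor nonzero.\<close>

lemma charpoly_similar:
  fixes K D Q R :: "real^'n^'n"
  assumes "K ** Q = Q ** D" "R ** Q = mat 1"
  shows "charpoly K = charpoly D"
proof -
  define c where "c A = (\<chi> i j. [:A $ i $ j:])" for A :: "real^'n^'n"
  define p where "p A = (\<chi> i j. [: - A $ i $ j, if i = j then 1 else 0 :])" for A :: "real^'n^'n"
  have sum_if: "(\<Sum>k\<in>UNIV. (if i = k then f k else 0)) = f i"
    "(\<Sum>k\<in>UNIV. (if k = i then f k else 0)) = f i" for f :: "'n \<Rightarrow> real" and i
    by (auto simp: sum.delta sum.delta')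
  have "[: - (K ** Q) $ i $ j, Q $ i $ j :] = (p K ** c Q) $ i $ j" for i j
    unfolding p_def c_def matrix_matrix_mult_def
    by (simp add: sum_linear_poly sum_negf mult.commute if_distrib[of "(*) _"] sum_if cong: if_cong)
  moreover have "[: - (Q ** D) $ i $ j, Q $ i $ j :] = (c Q ** p D) $ i $ j" for i j
    unfolding p_def c_def matrix_matrix_mult_def
    by (simp add: sum_linear_poly sum_negf mult.commute if_distrib[of "(*) _"] sum_if cong: if_cong)
  ultimately have "p K ** c Q = c Q ** p D"
    using assms(1) by (simp add: vec_eq_iff)
  then have "det (p K) * det (c Q) = det (p D) * det (c Q)"
    by (metis det_mul mult.commute)
  moreover have "c R ** c Q = mat 1"
  proof -
    have "(c R ** c Q) $ i $ j = [:(R ** Q) $ i $ j:]" for i j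
      unfolding c_def matrix_matrix_mult_def
      using sum_linear_poly[of "\<lambda>k. R $ i $ k * Q $ k $ j" "\<lambda>_. 0" UNIV]
      by (simp add: mult.commute)
    then show ?thesis using assms(2) by (simp add: vec_eq_iff mat_def one_pCons)
  qed
  then have "det (c Q) \<noteq> 0"
    by (metis det_I det_mul mult_zero_right zero_neq_one)
  ultimately show ?thesis by (simp add: charpoly_def p_def)
qed

text \<open>In the eigenbasis the matrix is diagonal, so its characteristic polynomial splits into
  linear factors and \<open>proots\<close> returns the eigenvalues with multiplicity. The
  enumeration \<open>e\<close> passes from the index type of matrices to natural numbers.\<close>

lemma proots_charpoly_eigenbasis:
  fixes K :: "real^'n^'n"
  assumes on: "\<And>i j. i < CARD('n) \<Longrightarrow> j < CARD('n) \<Longrightarrow> u i \<bullet> u j = (if i = j then 1 else 0)"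
    and eig: "\<And>i. i < CARD('n) \<Longrightarrow> K *v u i = c i *\<^sub>R u i"
  shows "proots (charpoly K) = mset (map c [0..<CARD('n)])"
proof -
  obtain e :: "'n \<Rightarrow> nat" where e: "bij_betw e UNIV {..<CARD('n)}"
    using ex_bij_betw_finite_nat[of "UNIV :: 'n set"] by (auto simp: lessThan_atLeast0)
  have e_less: "e i < CARD('n)" for i using e by (auto simp: bij_betw_def)
  have e_inj: "e i = e j \<longleftrightarrow> i = j" for i j using e by (auto simp: bij_betw_def inj_on_def)
  define Q :: "real^'n^'n" where "Q = (\<chi> i j. u (e j) $ i)"
  define D :: "real^'n^'n" where "D = (\<chi> i j. if i = j then c (e i) else 0)"
  have "K ** Q = Q ** D"
  proof -
    have "(K ** Q) $ i $ j = (K *v u (e j)) $ i" for i j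
      by (simp add: Q_def matrix_matrix_mult_def matrix_vector_mult_def)
    moreover have "(Q ** D) $ i $ j = c (e j) * u (e j) $ i" for i j
      by (simp add: Q_def D_def matrix_matrix_mult_def if_distrib[of "(*) _"] mult.commute cong: if_cong)
    ultimately show ?thesis using eig e_less by (simp add: vec_eq_iff)
  qed
  moreover have "transpose Q ** Q = mat 1"
  proof -
    have "(transpose Q ** Q) $ i $ j = u (e i) \<bullet> u (e j)" for i j
      by (simp add: Q_def matrix_matrix_mult_def transpose_def inner_vec_def)
    then show ?thesis using on e_less by (simp add: vec_eq_iff mat_def e_inj)
  qed
  ultimately have "charpoly K = charpoly D" by (rule charpoly_similar)
  also have "\<dots> = (\<Prod>i\<in>UNIV. [: - c (e i), 1 :])"
    unfolding charpoly_def by (subst det_diagonal) (auto simp: D_def)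
  finally have "proots (charpoly K) = (\<Sum>i\<in>UNIV. {#c (e i)#})"
    by (simp add: proots_prod)
  also have "\<dots> = (\<Sum>i\<in>{..<CARD('n)}. {#c i#})"
    using sum.reindex_bij_betw[OF e, of "\<lambda>i. {#c i#}"] .
  also have "(\<Sum>i<n. {#c i#}) = mset (map c [0..<n])" for n
    by (induction n) auto
  finally show ?thesis .
qed

section \<open>Right singular vectors, singular values and Courant-Fischer\<close>

text \<open>Right singular vectors with all singular values, including those past the smaller
  dimension, which \<open>singular_values\<close> drops. Left singular vectors are not
  stored.\<close>

definition singular_system :: "real^'n^'m \<Rightarrow> (nat \<Rightarrow> real^'n) \<Rightarrow> (nat \<Rightarrow> real) \<Rightarrow> bool" where
  "singular_system M u s \<longleftrightarrow>
     (\<forall>i<CARD('n). \<forall>j<CARD('n). u i \<bullet> u j = (if i = j then 1 else 0)) \<and>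
     (\<forall>i<CARD('n). (transpose M ** M) *v u i = (s i)\<^sup>2 *\<^sub>R u i) \<and>
     (\<forall>i<CARD('n). 0 \<le> s i) \<and>
     (\<forall>i<CARD('n). \<forall>j<CARD('n). i \<le> j \<longrightarrow> s j \<le> s i)"

lemma gram_inner: "((transpose M ** M) *v x) \<bullet> y = (M *v x) \<bullet> (M *v y)"
  for M :: "real^'n^'m"
  by (metis dot_lmul_matrix inner_commute matrix_vector_mul_assoc vector_transpose_matrix
        transpose_transpose)

lemma singular_system_exists: "\<exists>u s. singular_system (M :: real^'n^'m) u s"
proof -
  have "((transpose M ** M) *v x) \<bullet> y = x \<bullet> ((transpose M ** M) *v y)" for x y
    by (metis gram_inner inner_commute)
  then obtain u c where uc:
    "\<forall>i<CARD('n). (transpose M ** M) *v (u i) = c i *\<^sub>R u i"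
    "\<forall>i<CARD('n). \<forall>j<CARD('n). u i \<bullet> u j = (if i = j then 1 else 0)"
    "\<forall>i<CARD('n). \<forall>j<CARD('n). i \<le> j \<longrightarrow> c j \<le> c i"
    using selfadjoint_eigenbasis[of "(*v) (transpose M ** M)" UNIV] by auto
  have "0 \<le> c i" if "i < CARD('n)" for i
  proof -
    have "c i = (M *v u i) \<bullet> (M *v u i)"
      using uc(1,2) that by (simp flip: gram_inner)
    then show ?thesis by simp
  qed
  then have "singular_system M u (\<lambda>i. sqrt (c i))"
    using uc by (simp add: singular_system_def)
  then show ?thesis by blast
qed

lemma singular_systemD:
  fixes M :: "real^'n^'m"
  assumes "singular_system M u s"
  shows "i < CARD('n) \<Longrightarrow> j < CARD('n) \<Longrightarrow> u i \<bullet> u j = (if i = j then 1 else 0)"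
    and "i < CARD('n) \<Longrightarrow> (transpose M ** M) *v u i = (s i)\<^sup>2 *\<^sub>R u i"
    and "i < CARD('n) \<Longrightarrow> 0 \<le> s i"
    and "i \<le> j \<Longrightarrow> j < CARD('n) \<Longrightarrow> s j \<le> s i"
  using assms by (auto simp: singular_system_def)

lemma singular_values_system:
  fixes M :: "real^'n^'m"
  assumes "singular_system M u s"
  shows "singular_values M = map s [0..<min CARD('m) CARD('n)]"
proof -
  note S = singular_systemD[OF assms]
  let ?n = "CARD('n)"
  have "proots (charpoly (transpose M ** M)) = mset (map (\<lambda>i. (s i)\<^sup>2) [0..<?n])"
    using S by (intro proots_charpoly_eigenbasis[of u]) auto
  then have "image_mset sqrt (proots (charpoly (transpose M ** M)))
      = mset (map (\<lambda>i. sqrt ((s i)\<^sup>2)) [0..<?n])"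
    by (simp add: multiset.map_comp comp_def)
  also have "map (\<lambda>i. sqrt ((s i)\<^sup>2)) [0..<?n] = map s [0..<?n]"
    using S(3) by simp
  finally have "sorted_list_of_multiset (image_mset sqrt (proots (charpoly (transpose M ** M))))
      = sort (map s [0..<?n])"
    by (simp only: sorted_list_of_multiset_mset)
  \<comment> \<open>\<open>s\<close> is non-increasing, so sorting reverses it; the
    \<open>rev\<close> in the definition of \<open>singular_values\<close> undoes this before
    \<open>take\<close> cuts the tail.\<close>
  also have "\<dots> = rev (map s [0..<?n])"
    using S(4) by (intro properties_for_sort) (auto simp: sorted_wrt_iff_nth_less rev_nth)
  finally show ?thesis by (simp add: singular_values_def take_map)
qed

lemma length_singular_values: "length (singular_values M) = min CARD('m) CARD('n)"
  for M :: "real^'n^'m"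
  using singular_system_exists[of M] by (auto dest: singular_values_system)

lemma singular_system_norm:
  fixes M :: "real^'n^'m"
  assumes "singular_system M u s"
  shows "(norm x)\<^sup>2 = (\<Sum>i<CARD('n). (u i \<bullet> x)\<^sup>2)"
    and "(norm (M *v x))\<^sup>2 = (\<Sum>i<CARD('n). (s i)\<^sup>2 * (u i \<bullet> x)\<^sup>2)"
proof -
  note S = singular_systemD[OF assms]
  have x: "x = (\<Sum>i<CARD('n). (u i \<bullet> x) *\<^sub>R u i)"
    using orthonormal_expansion[of u x] S(1) by simp
  show "(norm x)\<^sup>2 = (\<Sum>i<CARD('n). (u i \<bullet> x)\<^sup>2)"
    by (subst x, rule orthonormal_norm_sum) (use S(1) in auto)
  have "(norm (M *v x))\<^sup>2 = ((transpose M ** M) *v x) \<bullet> x"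
    by (simp add: gram_inner power2_norm_eq_inner)
  also have "(transpose M ** M) *v x = (transpose M ** M) *v (\<Sum>i<CARD('n). (u i \<bullet> x) *\<^sub>R u i)"
    by (rule arg_cong[OF x])
  also have "\<dots> = (\<Sum>i<CARD('n). (u i \<bullet> x) *\<^sub>R ((s i)\<^sup>2 *\<^sub>R u i))"
    using S(2) by (simp add: linear_sum[OF matrix_vector_mul_linear] matrix_vector_mult_scaleR)
  also have "\<dots> \<bullet> x = (\<Sum>i<CARD('n). (s i)\<^sup>2 * (u i \<bullet> x)\<^sup>2)"
    by (simp add: inner_sum_left power2_eq_square algebra_simps)
  finally show "(norm (M *v x))\<^sup>2 = (\<Sum>i<CARD('n). (s i)\<^sup>2 * (u i \<bullet> x)\<^sup>2)" .
qed

text \<open>If \<open>s i\<close> were nonzero, the normalized images of the first i + 1 singular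
  vectors would be more than m orthonormal vectors in R^m. This controls the values that the list of
  singular values leaves out.\<close>

lemma singular_system_rank:
  fixes M :: "real^'n^'m"
  assumes "singular_system M u s" and i: "CARD('m) \<le> i" "i < CARD('n)"
  shows "s i = 0"
proof (rule ccontr)
  note S = singular_systemD[OF assms(1)]
  assume "s i \<noteq> 0"
  then have pos: "s j > 0" if "j \<le> i" for j
    using S(3)[OF i(2)] S(4)[OF that i(2)] by simp
  define w where "w j = (1 / s j) *\<^sub>R (M *v u j)" for j
  have "w j \<bullet> w k = (if j = k then 1 else 0)" if "j \<in> {..i}" "k \<in> {..i}" for j k
    using that i pos[of j] pos[of k] S(1)[of j k]
    by (simp add: w_def S(2) power2_eq_square flip: gram_inner)
  from dim_span_orthonormal[of "{..i}" w, OF this] have "dim (span (w ` {..i})) = Suc i"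
    by simp
  moreover have "dim (span (w ` {..i})) \<le> CARD('m)"
    using dim_subset_UNIV[of "span (w ` {..i})"] by simp
  ultimately show False using i by simp
qed

text \<open>The Courant--Fischer principle.\<close>

lemma le_singular_value_iff:
  fixes M :: "real^'n^'m"
  assumes i: "i < min CARD('m) CARD('n)"
  shows "t \<le> singular_values M ! i \<longleftrightarrow>
    (\<exists>W. subspace W \<and> i < dim W \<and> (\<forall>x\<in>W. t * norm x \<le> norm (M *v x)))"
proof -
  let ?n = "CARD('n)"
  obtain u s where us: "singular_system M u s" using singular_system_exists by blast
  note S = singular_systemD[OF us]
  note N = singular_system_norm[OF us]
  have i_n: "i < ?n" using i by simp
  have nth: "singular_values M ! i = s i"
    using i by (simp add: singular_values_system[OF us])
  have span_coeff_zero: "u j \<bullet> x = 0" if "x \<in> span (u ` I)" "I \<subseteq> {..<?n}" "j < ?n" "j \<notin> I" for x j I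
  proof -
    have "orthogonal (u j) x"
      using that S(1) by (intro orthogonal_to_span[OF that(1)]) (auto simp: orthogonal_def subset_iff)
    then show ?thesis by (simp add: orthogonal_def)
  qed
  have "\<exists>W. subspace W \<and> i < dim W \<and> (\<forall>x\<in>W. t * norm x \<le> norm (M *v x))" if t: "t \<le> s i"
  \<comment> \<open>On the span of the leading i + 1 singular vectors every coefficient has weight
    at least \<open>(s i)\<^sup>2\<close>. A nonpositive \<open>t\<close> is treated apart, since
    squaring would lose its sign.\<close>
  proof (intro exI[of _ "span (u ` {..i})"] conjI ballI)
    show "i < dim (span (u ` {..i}))"
      using dim_span_orthonormal[of "{..i}" u] S(1) i_n by simp
    fix x assume x: "x \<in> span (u ` {..i})"
    show "t * norm x \<le> norm (M *v x)"
    proof (cases "t \<le> 0")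
      case True
      then show ?thesis by (meson mult_nonpos_nonneg norm_ge_zero order_trans)
    next
      case False
      have "t\<^sup>2 * (u j \<bullet> x)\<^sup>2 \<le> (s j)\<^sup>2 * (u j \<bullet> x)\<^sup>2" if "j < ?n" for j
      proof (cases "j \<le> i")
        case True
        then show ?thesis
          using False t S(4)[OF True i_n] by (intro mult_right_mono power_mono) auto
      next
        case False
        then show ?thesis using span_coeff_zero[OF x _ that] i_n by (simp add: subset_iff)
      qed
      then have "(t * norm x)\<^sup>2 \<le> (norm (M *v x))\<^sup>2"
        unfolding power_mult_distrib N sum_distrib_left by (intro sum_mono) auto
      then show ?thesis using power2_le_imp_le norm_ge_zero by blast
    qed
  qed simp
  moreover have "t \<le> s i"
    if W: "subspace W" "i < dim W" and bound: "\<forall>x\<in>W. t * norm x \<le> norm (M *v x)" for W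
  proof -
    \<comment> \<open>\<open>U\<close> has dimension n - i and \<open>W\<close> at least i + 1, so
      they share a nonzero vector; on \<open>U\<close> no coefficient has weight above
      \<open>(s i)\<^sup>2\<close>.\<close>
    define U where "U = span (u ` {i..<?n})"
    have "dim U = ?n - i"
      unfolding U_def using dim_span_orthonormal[of "{i..<?n}" u] S(1) by simp
    moreover have "dim {x + y | x y. x \<in> W \<and> y \<in> U} + dim (W \<inter> U) = dim W + dim U"
      using W by (intro dim_sums_Int) (auto simp: U_def)
    moreover have "dim {x + y | x y. x \<in> W \<and> y \<in> U} \<le> ?n"
      using dim_subset_UNIV[of "{x + y | x y. x \<in> W \<and> y \<in> U}"] by simp
    ultimately have "dim (W \<inter> U) \<noteq> 0" using W(2) i_n by linarith
    then have "\<not> W \<inter> U \<subseteq> {0}" by (metis dim_eq_0)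
    then obtain x where x: "x \<in> W" "x \<in> U" "x \<noteq> 0" by blast
    have "(s j)\<^sup>2 * (u j \<bullet> x)\<^sup>2 \<le> (s i)\<^sup>2 * (u j \<bullet> x)\<^sup>2" if "j < ?n" for j
    proof (cases "i \<le> j")
      case True
      then show ?thesis
        using S(3,4) that by (intro mult_right_mono power_mono) auto
    next
      case False
      then show ?thesis using span_coeff_zero[OF x(2)[unfolded U_def] _ that] by (simp add: subset_iff)
    qed
    then have "(norm (M *v x))\<^sup>2 \<le> (s i * norm x)\<^sup>2"
      unfolding power_mult_distrib N sum_distrib_left by (intro sum_mono) auto
    then have "norm (M *v x) \<le> s i * norm x"
      by (rule power2_le_imp_le) (simp add: S(3)[OF i_n])
    with bound x(1) have "t * norm x \<le> s i * norm x" by (meson order_trans)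
    moreover have "0 < norm x" using x(3) by simp
    ultimately show ?thesis by (rule mult_right_le_imp_le)
  qed
  ultimately show ?thesis unfolding nth by blast
qed

text \<open>A subspace that witnesses the i-th singular value of \<open>M\<close> is carried by
  \<open>V\<close> to a witness for \<open>N\<close>: injectivity keeps its dimension, and
  \<open>V\<close> preserves the norm against which stretching is measured.\<close>

lemma singular_values_mono:
  fixes M N :: "real^'n^'m"
  assumes V: "orthogonal_transformation V" and le: "\<And>x. norm (M *v x) \<le> norm (N *v (V x))"
  shows "entrywise_le (singular_values M) (singular_values N)"
proof (rule list_all2_all_nthI)
  fix i assume "i < length (singular_values M)"
  then have i: "i < min CARD('m) CARD('n)" by (simp add: length_singular_values)
  have lin: "linear V" and inj: "inj V"
    using V by (auto simp: orthogonal_transformation_linear orthogonal_transformation_inj)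
  obtain W where W: "subspace W" "i < dim W"
    and bound: "\<forall>x\<in>W. singular_values M ! i * norm x \<le> norm (M *v x)"
    using le_singular_value_iff[OF i, of "singular_values M ! i" M] by auto
  show "singular_values M ! i \<le> singular_values N ! i"
    unfolding le_singular_value_iff[OF i]
  proof (intro exI[of _ "V ` W"] conjI ballI)
    show "subspace (V ` W)" using lin W(1) by (rule linear_subspace_image)
    show "i < dim (V ` W)"
      using dim_image_eq[OF lin, of W] W(2) inj by (simp add: inj_on_subset)
    fix y assume "y \<in> V ` W"
    then obtain x where x: "x \<in> W" "y = V x" by blast
    have "norm y = norm x" using V x(2) by (simp add: orthogonal_transformation_norm)
    then show "singular_values M ! i * norm y \<le> norm (N *v y)"
      using bound x le[of x] by force
  qed
qed (simp add: length_singular_values)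

text \<open>Instead of a limit of witness subspaces, the witness of a single \<open>X k\<close> is
  used: if the absolute entries of \<open>X k - M\<close> sum to less than \<open>e\<close>, it
  serves \<open>M\<close> at threshold \<open>t - e\<close>, and \<open>e\<close> is
  arbitrary.\<close>

lemma closed_singular_value_ge:
  assumes i: "i < min CARD('m) CARD('n)"
  shows "closed {M :: real^'n^'m. t \<le> singular_values M ! i}"
  unfolding closed_sequential_limits
proof (intro allI impI, elim conjE)
  fix X :: "nat \<Rightarrow> real^'n^'m" and M
  assume X: "\<forall>k. X k \<in> {M. t \<le> singular_values M ! i}" and lim: "X \<longlonglongrightarrow> M"
  have "t - e \<le> singular_values M ! i" if "e > 0" for e
  proof -
    have diff: "norm (A *v x) \<le> (\<Sum>i\<in>UNIV. \<Sum>j\<in>UNIV. \<bar>A $ i $ j\<bar>) * norm x"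
      for A :: "real^'n^'m" and x
      using onorm[OF matrix_vector_mul_bounded_linear, of A x] onorm_le_matrix_component_sum[of A]
      by (meson mult_right_mono norm_ge_zero order_trans)
    have "(\<lambda>k. \<Sum>i\<in>UNIV. \<Sum>j\<in>UNIV. \<bar>(X k - M) $ i $ j\<bar>) \<longlonglongrightarrow>
        (\<Sum>i\<in>UNIV. \<Sum>j\<in>UNIV. \<bar>(M - M) $ i $ j\<bar>)"
      by (intro tendsto_intros lim)
    then have "(\<lambda>k. \<Sum>i\<in>UNIV. \<Sum>j\<in>UNIV. \<bar>(X k - M) $ i $ j\<bar>) \<longlonglongrightarrow> 0"
      by simp
    from order_tendstoD(2)[OF this \<open>e > 0\<close>] obtain k
      where k: "(\<Sum>i\<in>UNIV. \<Sum>j\<in>UNIV. \<bar>(X k - M) $ i $ j\<bar>) < e"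
      by (auto simp: eventually_sequentially)
    obtain W where W: "subspace W" "i < dim W" and bound: "\<forall>x\<in>W. t * norm x \<le> norm (X k *v x)"
      using X le_singular_value_iff[OF i, of t "X k"] by auto
    show ?thesis
      unfolding le_singular_value_iff[OF i]
    proof (intro exI[of _ W] conjI ballI W)
      fix x assume "x \<in> W"
      have "norm ((X k - M) *v x) \<le> e * norm x"
        using diff[of "X k - M" x] k by (meson mult_right_mono norm_ge_zero order_trans less_imp_le)
      moreover have "norm (X k *v x) \<le> norm (M *v x) + norm ((X k - M) *v x)"
        by (metis add.commute matrix_vector_mult_diff_rdistrib norm_triangle_sub)
      ultimately show "(t - e) * norm x \<le> norm (M *v x)"
        using bound \<open>x \<in> W\<close> by (fastforce simp: left_diff_distrib)
    qed
  qed
  then show "M \<in> {M. t \<le> singular_values M ! i}"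
    using field_le_epsilon[of t] by (simp add: algebra_simps)
qed

text \<open>\<open>V\<close> sends the i-th right singular vector of \<open>B\<close> to the i-th of
  \<open>A\<close>, so both squared norms become sums over the same squared coefficients, with
  weights \<open>(r i)\<^sup>2\<close> and \<open>(s i)\<^sup>2\<close>.\<close>

lemma singular_values_le_imp_norm_le:
  fixes A B :: "real^'n^'m"
  assumes "entrywise_le (singular_values B) (singular_values A)"
  obtains V where "orthogonal_transformation V" "\<And>x. norm (B *v x) \<le> norm (A *v (V x))"
proof -
  let ?n = "CARD('n)"
  obtain u s where us: "singular_system A u s" using singular_system_exists by blast
  obtain v r where vr: "singular_system B v r" using singular_system_exists by blast
  note S = singular_systemD[OF us] and R = singular_systemD[OF vr]
  have le: "r i \<le> s i" if "i < ?n" for i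
  proof (cases "i < CARD('m)")
    case True
    then show ?thesis
      using assms that by (auto simp: singular_values_system[OF us] singular_values_system[OF vr]
          list_all2_conv_all_nth)
  next
    \<comment> \<open>Indices from \<open>CARD('m)\<close> on are absent from the lists being
      compared; there \<open>r i\<close> vanishes.\<close>
    case False
    then show ?thesis using singular_system_rank[OF vr, of i] S(3)[of i] that by simp
  qed
  define V where "V x = (\<Sum>i<?n. (v i \<bullet> x) *\<^sub>R u i)" for x
  have "linear V"
    unfolding V_def
    by (intro linearI) (simp_all add: inner_add_right scaleR_add_left sum.distrib scaleR_sum_right)
  moreover have norm: "norm (V x) = norm x" for x
  proof -
    have "(norm (V x))\<^sup>2 = (\<Sum>i<?n. (v i \<bullet> x)\<^sup>2)"
      unfolding V_def by (rule orthonormal_norm_sum) (rule S(1))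
    also have "\<dots> = (norm x)\<^sup>2"
      by (rule singular_system_norm(1)[OF vr, symmetric])
    finally show ?thesis by simp
  qed
  ultimately have orth: "orthogonal_transformation V"
    by (simp add: orthogonal_transformation)
  have coeff: "u i \<bullet> V x = v i \<bullet> x" if "i < ?n" for i x
  proof -
    have "u i \<bullet> V x = (\<Sum>j<?n. if i = j then v j \<bullet> x else 0)"
      unfolding V_def inner_sum_right using S(1) that by (intro sum.cong) auto
    then show ?thesis using that by simp
  qed
  have "norm (B *v x) \<le> norm (A *v (V x))" for x
  proof -
    have "(norm (B *v x))\<^sup>2 \<le> (norm (A *v (V x)))\<^sup>2"
      unfolding singular_system_norm(2)[OF vr] singular_system_norm(2)[OF us]
      by (intro sum_mono) (simp add: coeff mult_right_mono power_mono le R(3))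
    then show ?thesis by (rule power2_le_imp_le) simp
  qed
  with orth show thesis by (rule that)
qed

section \<open>The residual as a function of the test matrix\<close>

lemma orth_projector_subspace:
  fixes S :: "(real^'m) set"
  assumes "subspace S"
  shows "orth_projector S ** orth_projector S = orth_projector S"
    and "transpose (orth_projector S) = orth_projector S"
    and "range ((*v) (orth_projector S)) = S"
  using theI'[OF orth_projector_ex1[OF assms]] by (auto simp: orth_projector_def)

lemma orth_projector_fixes:
  fixes S :: "(real^'m) set"
  assumes "subspace S" "s \<in> S"
  shows "orth_projector S *v s = s"
proof -
  obtain w where "s = orth_projector S *v w"
    using orth_projector_subspace(3)[OF assms(1)] assms(2) by blast
  then show ?thesis by (simp add: matrix_vector_mul_assoc orth_projector_subspace(1)[OF assms(1)])
qed

lemma orth_projector_residual_orthogonal: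
  fixes S :: "(real^'m) set"
  assumes "subspace S" "s \<in> S"
  shows "orthogonal ((mat 1 - orth_projector S) *v y) s"
proof -
  let ?P = "orth_projector S"
  have sym: "(?P *v x) \<bullet> z = x \<bullet> (?P *v z)" for x z
    by (metis dot_lmul_matrix orth_projector_subspace(2)[OF assms(1)] vector_transpose_matrix)
  have "(y - ?P *v y) \<bullet> s = y \<bullet> s - y \<bullet> (?P *v s)"
    by (simp add: inner_diff_left sym)
  then show ?thesis
    by (simp add: orthogonal_def matrix_vector_mult_diff_rdistrib orth_projector_fixes[OF assms])
qed

lemma norm_orth_projector_residual_le:
  fixes S :: "(real^'m) set"
  assumes "subspace S" "s \<in> S"
  shows "norm ((mat 1 - orth_projector S) *v y) \<le> norm (y - s)"
proof -
  let ?P = "orth_projector S"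
  have P: "?P *v y - s \<in> S"
    using orth_projector_subspace(3)[OF assms(1)] assms by (metis rangeI subspace_diff)
  have "(norm ((mat 1 - ?P) *v y + (?P *v y - s)))\<^sup>2
      = (norm ((mat 1 - ?P) *v y))\<^sup>2 + (norm (?P *v y - s))\<^sup>2"
    by (rule norm_add_Pythagorean) (rule orth_projector_residual_orthogonal[OF assms(1) P])
  then have "(norm ((mat 1 - ?P) *v y))\<^sup>2 \<le> (norm (y - s))\<^sup>2"
    by (simp add: matrix_vector_mult_diff_rdistrib)
  then show ?thesis by (rule power2_le_imp_le) simp
qed

lemma subspace_range_matrix: "subspace (range ((*v) (H :: real^'l^'m)))"
  by (intro linear_subspace_image) auto

text \<open>The norm on the left is the distance from \<open>y\<close> to the range, attained at the
  projection. The strict form hides the minimizer in an existential quantifier and, for varying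
  \<open>H\<close>, exhibits a union of open conditions.\<close>

lemma norm_range_residual_less_iff:
  fixes H :: "real^'l^'m"
  shows "norm ((mat 1 - orth_projector (range ((*v) H))) *v y) < c \<longleftrightarrow> (\<exists>z. norm (y - H *v z) < c)"
proof -
  let ?P = "orth_projector (range ((*v) H))"
  have "?P *v y \<in> range ((*v) H)"
    using orth_projector_subspace(3)[OF subspace_range_matrix, of H] by blast
  then obtain z where "?P *v y = H *v z" by blast
  then have "norm ((mat 1 - ?P) *v y) = norm (y - H *v z)"
    by (simp add: matrix_vector_mult_diff_rdistrib)
  moreover have "norm ((mat 1 - ?P) *v y) \<le> norm (y - H *v z)" for z
    by (intro norm_orth_projector_residual_le subspace_range_matrix rangeI)
  ultimately show ?thesis using le_less_trans by auto
qed

lemma norm_residual_less_iff: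
  "norm (residual A G *v x) < c \<longleftrightarrow> (\<exists>z. norm (A *v (x - G *v z)) < c)"
  unfolding residual_def matrix_vector_mul_assoc[symmetric] norm_range_residual_less_iff
  by (simp add: matrix_vector_mult_diff_distrib)

text \<open>Turning both x and G by V turns x - G z into V (x - G z) with the same z; the bound
  \<open>le\<close> at x - G z then passes to the minima over z.\<close>

lemma singular_values_residual_mono:
  fixes A B :: "real^'n^'m" and G :: "real^'l^'n"
  assumes V: "orthogonal_transformation V" and le: "\<And>x. norm (B *v x) \<le> norm (A *v (V x))"
  shows "entrywise_le (singular_values (residual B G)) (singular_values (residual A (matrix V ** G)))"
proof (rule singular_values_mono[OF V])
  fix x
  have lin: "linear V" using V by (rule orthogonal_transformation_linear)
  have "norm (residual B G *v x) < c" if c: "norm (residual A (matrix V ** G) *v V x) < c" for c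
  proof -
    obtain z where "norm (A *v (V x - (matrix V ** G) *v z)) < c"
      using c unfolding norm_residual_less_iff by blast
    moreover have "V x - (matrix V ** G) *v z = V (x - G *v z)"
      using lin by (simp add: linear_diff matrix_works flip: matrix_vector_mul_assoc)
    ultimately have "norm (B *v (x - G *v z)) < c"
      using le[of "x - G *v z"] by simp
    then show ?thesis unfolding norm_residual_less_iff by blast
  qed
  then show "norm (residual B G *v x) \<le> norm (residual A (matrix V ** G) *v V x)"
    by (meson less_irrefl not_le)
qed

section \<open>Borel measurability of the residual and its singular values\<close>

lemma borel_measurable_matrix:
  fixes f :: "'a \<Rightarrow> real^'n^'m"
  assumes "\<And>i j. (\<lambda>x. f x $ i $ j) \<in> borel_measurable M"
  shows "f \<in> borel_measurable M"
proof (subst borel_measurable_euclidean_space, intro ballI)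
  fix b :: "real^'n^'m" assume "b \<in> Basis"
  then obtain i j where "b = axis i (axis j 1)" by (auto simp: Basis_vec_def)
  then show "(\<lambda>x. f x \<bullet> b) \<in> borel_measurable M"
    using assms by (simp add: inner_axis)
qed

text \<open>Continuity in \<open>H\<close> can fail where the rank drops, but for fixed
  \<open>y\<close> the distance from \<open>y\<close> to the range is an infimum of continuous
  functions of \<open>H\<close>, hence upper semicontinuous and Borel. Polarization recovers the
  matrix entries from such distances.\<close>

lemma borel_measurable_range_residual:
  "(\<lambda>H :: real^'l^'m. mat 1 - orth_projector (range ((*v) H))) \<in> borel_measurable borel"
proof (rule borel_measurable_matrix)
  fix i j
  define R where "R H = mat 1 - orth_projector (range ((*v) H))" for H :: "real^'l^'m"
  have norm_meas [measurable]: "(\<lambda>H. norm (R H *v y)) \<in> borel_measurable borel" for y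
  proof (rule borel_measurableI_less)
    fix c
    have "{H. norm (R H *v y) < c} = (\<Union>z. {H. norm (y - H *v z) < c})"
      by (auto simp: R_def norm_range_residual_less_iff)
    also have "open \<dots>"
      unfolding matrix_vector_mult_def
      by (intro open_UN ballI open_Collect_less continuous_on_norm continuous_on_diff
        continuous_on_vec_lambda continuous_on_sum continuous_on_mult continuous_on_const
        continuous_on_component continuous_on_id)
    finally show "{H \<in> space borel. norm (R H *v y) < c} \<in> sets borel" by simp
  qed
  \<comment> \<open>\<open>R H\<close> is itself an orthogonal projector, so its entry at (i, j) is
    the inner product of its i-th and j-th columns, a combination of three squared norms.\<close>
  have polar: "R H $ i $ j =
    ((norm (R H *v (axis i 1 + axis j 1)))\<^sup>2 - (norm (R H *v axis i 1))\<^sup>2 - (norm (R H *v axis j 1))\<^sup>2) / 2"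
    for H
  proof -
    have "R H *v x = x - orth_projector (range ((*v) H)) *v x" for x
      by (simp add: R_def matrix_vector_mult_diff_rdistrib)
    moreover have "(R H *v axis j 1) \<bullet> (orth_projector (range ((*v) H)) *v axis i 1) = 0"
      using orth_projector_residual_orthogonal[OF subspace_range_matrix]
        orth_projector_subspace(3)[OF subspace_range_matrix, of H]
      unfolding R_def orthogonal_def by blast
    ultimately have "(R H *v axis j 1) \<bullet> (R H *v axis i 1) = (R H *v axis j 1) \<bullet> axis i 1"
      by (metis inner_diff_right diff_zero)
    also have "\<dots> = R H $ i $ j"
      by (simp add: inner_axis matrix_vector_mult_basis column_def)
    finally show ?thesis
      by (simp add: matrix_vector_right_distrib power2_norm_eq_inner inner_simps inner_commute)
  qed
  show "(\<lambda>H :: real^'l^'m. (mat 1 - orth_projector (range ((*v) H))) $ i $ j) \<in> borel_measurable borel"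
    unfolding R_def[symmetric] polar by measurable
qed

lemma borel_measurable_residual:
  fixes A :: "real^'n^'m"
  shows "(residual A :: real^'l^'n \<Rightarrow> _) \<in> borel_measurable borel"
proof -
  have "(\<lambda>G :: real^'l^'n. A ** G) \<in> borel_measurable borel"
    unfolding matrix_matrix_mult_def
    by (intro borel_measurable_continuous_onI
        continuous_on_vec_lambda continuous_on_sum continuous_on_mult continuous_on_const
        continuous_on_component continuous_on_id)
  from measurable_compose[OF this borel_measurable_range_residual]
  have "(\<lambda>G :: real^'l^'n. mat 1 - orth_projector (range ((*v) (A ** G)))) \<in> borel_measurable borel" .
  moreover have "(\<lambda>R. R ** A) \<in> borel_measurable borel"
    unfolding matrix_matrix_mult_def
    by (intro borel_measurable_continuous_onI
        continuous_on_vec_lambda continuous_on_sum continuous_on_mult continuous_on_const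
        continuous_on_component continuous_on_id)
  ultimately show ?thesis
    unfolding residual_def[abs_def] by (rule measurable_compose)
qed

lemma singular_values_residual_sets:
  fixes A :: "real^'n^'m"
  assumes "length x = min CARD('m) CARD('n)"
  shows "{G :: real^'l^'n. entrywise_le x (singular_values (residual A G))} \<in> sets borel"
proof -
  have "{G :: real^'l^'n. entrywise_le x (singular_values (residual A G))}
      = residual A -` (\<Inter>i\<in>{..<min CARD('m) CARD('n)}. {M. x ! i \<le> singular_values M ! i}) \<inter> space borel"
    using assms by (auto simp: list_all2_conv_all_nth length_singular_values)
  also have "\<dots> \<in> sets borel"
    by (intro measurable_sets[OF borel_measurable_residual] borel_closed closed_INT ballI
        closed_singular_value_ge) simp
  finally show ?thesis .
qed

section \<open>Orthogonal invariance of Gaussian matrices\<close>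

lemma nn_integral_lborel_translate:
  fixes f :: "'a::euclidean_space \<Rightarrow> ennreal"
  assumes "f \<in> borel_measurable borel"
  shows "(\<integral>\<^sup>+x. f (c + x) \<partial>lborel) = (\<integral>\<^sup>+x. f x \<partial>lborel)"
proof -
  have "(\<integral>\<^sup>+x. f x \<partial>distr lborel borel ((+) c)) = (\<integral>\<^sup>+x. f (c + x) \<partial>lborel)"
    using assms by (intro nn_integral_distr) auto
  then show ?thesis by (simp add: lborel_distr_plus)
qed

text \<open>The two measures of \<open>A\<close> are compared by evaluating
  \<open>\<integral>\<integral> 1\<^sub>A (T x) 1\<^sub>B (y - T x) dx dy\<close>, with \<open>B\<close> the unit ball, in two ways: by integrating over
  \<open>y\<close> first, and after the substitution that replaces \<open>T x\<close> by \<open>y + T x\<close>.\<close>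

lemma distr_lborel_orthogonal_transformation:
  fixes T :: "'a::euclidean_space \<Rightarrow> 'a"
  assumes T: "orthogonal_transformation T"
  shows "distr lborel borel T = lborel"
proof (rule measure_eqI)
  have lin: "linear T" using T by (rule orthogonal_transformation_linear)
  have T_meas [measurable]: "T \<in> borel_measurable borel"
    by (intro borel_measurable_continuous_onI linear_continuous_on) (simp add: lin linear_linear)
  fix A assume "A \<in> sets (distr lborel borel T)"
  then have A [measurable]: "A \<in> sets borel" by simp
  define B :: "'a set" where "B = ball 0 1"
  have B [measurable]: "B \<in> sets borel" by (simp add: B_def)
  have "(\<integral>\<^sup>+x. \<integral>\<^sup>+y. indicator A (T x) * indicator B (y - T x) \<partial>lborel \<partial>lborel)
      = (\<integral>\<^sup>+x. indicator A (T x) * emeasure lborel B \<partial>lborel)"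
  proof (rule nn_integral_cong)
    fix x
    have "(\<integral>\<^sup>+y. indicator B (- T x + y) \<partial>lborel) = (\<integral>\<^sup>+y. indicator B y \<partial>lborel)"
      by (rule nn_integral_lborel_translate) measurable
    then show "(\<integral>\<^sup>+y. indicator A (T x) * indicator B (y - T x) \<partial>lborel)
        = indicator A (T x) * emeasure lborel B"
      by (simp add: nn_integral_cmult)
  qed
  also have "\<dots> = emeasure (distr lborel borel T) A * emeasure lborel B"
    by (simp add: nn_integral_multc emeasure_distr nn_integral_distr flip: nn_integral_indicator)
  finally have 1: "(\<integral>\<^sup>+x. \<integral>\<^sup>+y. indicator A (T x) * indicator B (y - T x) \<partial>lborel \<partial>lborel)
      = emeasure (distr lborel borel T) A * emeasure lborel B" .
  have "(\<integral>\<^sup>+x. \<integral>\<^sup>+y. indicator A (T x) * indicator B (y - T x) \<partial>lborel \<partial>lborel)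
      = (\<integral>\<^sup>+y. \<integral>\<^sup>+x. indicator A (T x) * indicator B (y - T x) \<partial>lborel \<partial>lborel)"
    by (rule lborel_pair.Fubini'[symmetric]) measurable
  also have "\<dots> = (\<integral>\<^sup>+y. \<integral>\<^sup>+x. indicator A (y + T x) * indicator B (- T x) \<partial>lborel \<partial>lborel)"
  proof (rule nn_integral_cong)
    fix y
    obtain z where z: "T z = y"
      using orthogonal_transformation_surj[OF T] by (metis surjD)
    have "(\<integral>\<^sup>+x. indicator A (T x) * indicator B (y - T x) \<partial>lborel)
        = (\<integral>\<^sup>+x. indicator A (T (z + x)) * indicator B (y - T (z + x)) \<partial>lborel)"
      by (rule nn_integral_lborel_translate[symmetric]) measurable
    then show "(\<integral>\<^sup>+x. indicator A (T x) * indicator B (y - T x) \<partial>lborel)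
        = (\<integral>\<^sup>+x. indicator A (y + T x) * indicator B (- T x) \<partial>lborel)"
      by (simp add: linear_add[OF lin] z)
  qed
  also have "\<dots> = (\<integral>\<^sup>+x. \<integral>\<^sup>+y. indicator A (y + T x) * indicator B (- T x) \<partial>lborel \<partial>lborel)"
    by (rule lborel_pair.Fubini') measurable
  also have "\<dots> = (\<integral>\<^sup>+x. emeasure lborel A * indicator B x \<partial>lborel)"
  proof (rule nn_integral_cong)
    fix x
    have "(\<integral>\<^sup>+y. indicator A (T x + y) \<partial>lborel) = (\<integral>\<^sup>+y. indicator A y \<partial>lborel)"
      by (rule nn_integral_lborel_translate) measurable
    also have "\<dots> = emeasure lborel A" by simp
    finally have "(\<integral>\<^sup>+y. indicator A (y + T x) \<partial>lborel) = emeasure lborel A"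
      by (simp only: add.commute)
    \<comment> \<open>\<open>B\<close> is a ball about the origin and \<open>T\<close> preserves
      norms, so \<open>- T x\<close> lies in \<open>B\<close> exactly when \<open>x\<close>
      does.\<close>
    moreover have "indicator B (- T x) = (indicator B x :: ennreal)"
      using T by (simp add: B_def orthogonal_transformation_norm indicator_def)
    ultimately show "(\<integral>\<^sup>+y. indicator A (y + T x) * indicator B (- T x) \<partial>lborel)
        = emeasure lborel A * indicator B x"
      by (simp add: nn_integral_multc)
  qed
  also have "\<dots> = emeasure lborel A * emeasure lborel B"
    by (simp add: nn_integral_cmult)
  finally have "emeasure (distr lborel borel T) A * emeasure lborel B
      = emeasure lborel A * emeasure lborel B"
    using 1 by simp
  moreover have "emeasure lborel B < \<infinity>"
    unfolding B_def by (rule emeasure_bounded_finite) simp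
  moreover have "emeasure lborel B \<noteq> 0"
    using content_ball_pos[of 1 "0 :: 'a"] by (auto simp: B_def measure_def)
  ultimately show "emeasure (distr lborel borel T) A = emeasure lborel A"
    by (auto simp: mult.commute[of _ "emeasure lborel B"] ennreal_mult_cancel_left)
qed simp

section \<open>The standard Gaussian law on a Euclidean space\<close>

text \<open>Stated for an arbitrary Euclidean space so that a matrix counts as one vector and left
  multiplication by an orthogonal matrix as one orthogonal map. The product over
  \<open>Basis\<close> suits independent entries; rotation invariance uses the radial form
  instead.\<close>

definition std_gaussian :: "'a::euclidean_space measure" where
  "std_gaussian = density lborel (\<lambda>x. \<Prod>b\<in>Basis. ennreal (std_normal_density (x \<bullet> b)))"

lemma sets_std_gaussian [measurable_cong]: "sets std_gaussian = sets borel"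
  by (simp add: std_gaussian_def)

lemma emeasure_std_gaussian_box:
  "emeasure std_gaussian (box l u :: 'a::euclidean_space set)
     = (\<Prod>b\<in>Basis. emeasure (density lborel std_normal_density) {l \<bullet> b<..<u \<bullet> b})"
proof -
  have "emeasure std_gaussian (box l u)
      = (\<integral>\<^sup>+x. (\<Prod>b\<in>Basis. ennreal (std_normal_density (x \<bullet> b))) * indicator (box l u) x \<partial>lborel)"
    unfolding std_gaussian_def by (rule emeasure_density) auto
  also have "\<dots> = (\<integral>\<^sup>+x. (\<Prod>b\<in>Basis. ennreal (std_normal_density (x \<bullet> b))
      * indicator {l \<bullet> b<..<u \<bullet> b} (x \<bullet> b)) \<partial>lborel)"
  proof (rule nn_integral_cong)
    fix x :: 'a
    have "indicator (box l u) x = (\<Prod>b\<in>Basis. indicator {l \<bullet> b<..<u \<bullet> b} (x \<bullet> b) :: ennreal)"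
      by (auto simp: indicator_def mem_box prod_zero_iff)
    then show "(\<Prod>b\<in>Basis. ennreal (std_normal_density (x \<bullet> b))) * indicator (box l u) x
        = (\<Prod>b\<in>Basis. ennreal (std_normal_density (x \<bullet> b)) * indicator {l \<bullet> b<..<u \<bullet> b} (x \<bullet> b))"
      by (simp add: prod.distrib)
  qed
  also have "\<dots> = (\<Prod>b\<in>Basis. \<integral>\<^sup>+y. ennreal (std_normal_density y) * indicator {l \<bullet> b<..<u \<bullet> b} y \<partial>lborel)"
    by (rule nn_integral_lborel_prod) auto
  also have "\<dots> = (\<Prod>b\<in>Basis. emeasure (density lborel std_normal_density) {l \<bullet> b<..<u \<bullet> b})"
    by (intro prod.cong refl emeasure_density[symmetric]) auto
  finally show ?thesis .
qed

text \<open>The product of the coordinate densities depends only on \<open>x \<bullet> x\<close>,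
  which \<open>T\<close> preserves, and Lebesgue measure is itself invariant under
  \<open>T\<close>.\<close>

lemma distr_std_gaussian_orthogonal_transformation:
  fixes T :: "'a::euclidean_space \<Rightarrow> 'a"
  assumes T: "orthogonal_transformation T"
  shows "distr std_gaussian borel T = std_gaussian"
proof -
  let ?f = "\<lambda>x :: 'a. \<Prod>b\<in>Basis. ennreal (std_normal_density (x \<bullet> b))"
  have T_meas: "T \<in> borel_measurable borel"
    using orthogonal_transformation_linear[OF T]
    by (intro borel_measurable_continuous_onI linear_continuous_on) (simp add: linear_linear)
  have radial: "?f x = ennreal (\<Prod>b\<in>(Basis :: 'a set). 1 / sqrt (2 * pi)) * ennreal (exp (- (x \<bullet> x) / 2))"
    for x :: 'a
  proof -
    have "?f x = ennreal (\<Prod>b\<in>Basis. std_normal_density (x \<bullet> b))"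
      by (simp add: prod_ennreal)
    also have "(\<Prod>b\<in>Basis. std_normal_density (x \<bullet> b))
        = (\<Prod>b\<in>(Basis :: 'a set). 1 / sqrt (2 * pi)) * exp (\<Sum>b\<in>Basis. - (x \<bullet> b)\<^sup>2 / 2)"
      unfolding std_normal_density_def prod.distrib by (simp add: exp_sum)
    also have "(\<Sum>b\<in>Basis. - (x \<bullet> b)\<^sup>2 / 2) = - (x \<bullet> x) / 2"
      unfolding euclidean_inner[of x x]
      by (simp add: sum_negf sum_divide_distrib[symmetric] power2_eq_square)
    finally show ?thesis by (simp add: ennreal_mult')
  qed
  have "?f (T x) = ?f x" for x
    using T unfolding radial by (simp add: orthogonal_transformation_def)
  then have "distr std_gaussian borel T = distr (density lborel (?f \<circ> T)) borel T"
    by (simp add: std_gaussian_def comp_def)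
  also have "\<dots> = density (distr lborel borel T) ?f"
    using T_meas by (subst density_distr) (auto simp: comp_def)
  finally show ?thesis
    by (simp add: distr_lborel_orthogonal_transformation[OF T] std_gaussian_def)
qed

text \<open>Boxes generate the Borel sets and are stable under intersection, so agreement on boxes
  suffices. There independence splits the probability into one-dimensional Gaussian masses.\<close>

lemma distr_std_gaussian_matrix:
  fixes G :: "'w \<Rightarrow> real^'l^'n"
  assumes "prob_space M" and G: "std_gaussian_matrix M G"
  shows "G \<in> borel_measurable M" and "distr M borel G = std_gaussian"
proof -
  interpret prob_space M by fact
  have indep: "indep_vars (\<lambda>_. borel) (\<lambda>(i, j) \<omega>. G \<omega> $ i $ j) UNIV"
    and dist: "distributed M lborel (\<lambda>\<omega>. G \<omega> $ i $ j) std_normal_density" for i j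
    using G by (auto simp: std_gaussian_matrix_def)
  have comp_meas [measurable]: "(\<lambda>\<omega>. G \<omega> $ i $ j) \<in> borel_measurable M" for i j
    using distributed_measurable[OF dist] by simp
  show meas [measurable]: "G \<in> borel_measurable M"
    by (rule borel_measurable_matrix) (rule comp_meas)
  have box: "emeasure (distr M borel G) (box l u) = emeasure std_gaussian (box l u)" for l u
  proof -
    let ?I = "\<lambda>(i, j). {l $ i $ j<..<u $ i $ j}"
    let ?X = "\<lambda>(i, j) \<omega>. G \<omega> $ i $ j"
    \<comment> \<open>Basis vectors of the matrix space are the matrix units, so a product over
      pairs (i, j) is a product over \<open>Basis\<close>.\<close>
    have bij: "bij_betw (\<lambda>(i, j). axis i (axis j 1)) UNIV (Basis :: (real^'l^'n) set)"
      by (auto simp: bij_betw_def inj_on_def axis_eq_axis Basis_vec_def)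
    have "G -` box l u \<inter> space M = (\<Inter>p\<in>UNIV. ?X p -` ?I p \<inter> space M)"
      by (auto simp: mem_box Basis_vec_def inner_axis)
    then have "emeasure (distr M borel G) (box l u) = ennreal (prob (\<Inter>p\<in>UNIV. ?X p -` ?I p \<inter> space M))"
      by (simp add: emeasure_distr emeasure_eq_measure)
    also have "\<dots> = (\<Prod>p\<in>UNIV. ennreal (prob (?X p -` ?I p \<inter> space M)))"
      by (subst indep_varsD_finite[OF indep]) (auto simp: prod_ennreal)
    also have "\<dots> = (\<Prod>p\<in>UNIV. emeasure (density lborel std_normal_density) (?I p))"
    proof (rule prod.cong[OF refl])
      fix p :: "'n \<times> 'l"
      obtain i j where p: "p = (i, j)" by (cases p)
      have "emeasure (density lborel std_normal_density) (?I (i, j))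
          = emeasure (distr M lborel (\<lambda>\<omega>. G \<omega> $ i $ j)) (?I (i, j))"
        by (simp only: distributed_distr_eq_density[OF dist])
      then show "ennreal (prob (?X p -` ?I p \<inter> space M))
          = emeasure (density lborel std_normal_density) (?I p)"
        by (simp add: p emeasure_distr emeasure_eq_measure)
    qed
    also have "\<dots> = (\<Prod>b\<in>Basis. emeasure (density lborel std_normal_density) {l \<bullet> b<..<u \<bullet> b})"
      by (subst prod.reindex_bij_betw[OF bij, symmetric])
         (auto intro!: prod.cong simp: inner_axis)
    finally show ?thesis by (simp only: emeasure_std_gaussian_box)
  qed
  show "distr M borel G = std_gaussian"
  proof (rule measure_eqI_generator_eq)
    let ?E = "range (\<lambda>(a, b). box a b :: (real^'l^'n) set)"
    let ?A = "\<lambda>n::nat. box (- (real n *\<^sub>R One)) (real n *\<^sub>R One) :: (real^'l^'n) set"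
    show "Int_stable ?E"
      by (auto simp: Int_stable_def box_Int_box)
    show "?E \<subseteq> Pow UNIV" "sets (distr M borel G) = sigma_sets UNIV ?E"
      "sets std_gaussian = sigma_sets UNIV ?E"
      by (simp_all add: borel_eq_box sets_std_gaussian)
    show "range ?A \<subseteq> ?E" "(\<Union>i. ?A i) = UNIV"
      unfolding UN_box_eq_UNIV by auto
    show "emeasure (distr M borel G) (?A i) \<noteq> \<infinity>" for i
      by (simp add: emeasure_distr emeasure_eq_measure)
    show "emeasure (distr M borel G) X = emeasure std_gaussian X" if "X \<in> ?E" for X
      using that box by auto
  qed
qed

text \<open>The norm on matrices is the Frobenius norm, whose square is the sum of the squared
  column norms, and \<open>V\<close> acts on each column separately.\<close>

lemma orthogonal_transformation_matrix_mult:
  fixes V :: "real^'n \<Rightarrow> real^'n"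
  assumes V: "orthogonal_transformation V"
  shows "orthogonal_transformation (\<lambda>G :: real^'l^'n. matrix V ** G)"
  unfolding orthogonal_transformation
proof (intro conjI allI)
  show "linear (\<lambda>G :: real^'l^'n. matrix V ** G)"
    by (intro linearI) (simp_all add: vec_eq_iff matrix_matrix_mult_def sum.distrib
        distrib_left sum_distrib_left algebra_simps)
  fix G :: "real^'l^'n"
  have sq: "(norm X)\<^sup>2 = (\<Sum>j\<in>UNIV. (norm (column j X))\<^sup>2)" for X :: "real^'l^'n"
    unfolding power2_norm_eq_inner by (simp add: inner_vec_def column_def) (rule sum.swap)
  have col: "column j (matrix V ** G) = V (column j G)" for j
  proof -
    have "column j (matrix V ** G) = matrix V *v column j G"
      by (simp add: vec_eq_iff column_def matrix_matrix_mult_def matrix_vector_mult_def)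
    also have "\<dots> = V (column j G)"
      using matrix_works[of V "column j G"] orthogonal_transformation_linear[OF V] by simp
    finally show ?thesis .
  qed
  have "(norm (matrix V ** G))\<^sup>2 = (norm G)\<^sup>2"
    using V by (simp add: sq col orthogonal_transformation_norm)
  then show "norm (matrix V ** G) = norm G" by simp
qed

theorem lemma2p1:
  fixes A B :: "real^'n^'m"
    and M\<^sub>A :: "'v measure" and G\<^sub>A :: "'v \<Rightarrow> real^'l^'n"
    and M\<^sub>B :: "'w measure" and G\<^sub>B :: "'w \<Rightarrow> real^'l^'n"
  assumes "1 \<le> CARD('l)" and "CARD('l) \<le> min CARD('m) CARD('n)"
    and "prob_space M\<^sub>A" and "std_gaussian_matrix M\<^sub>A G\<^sub>A"
    and "prob_space M\<^sub>B" and "std_gaussian_matrix M\<^sub>B G\<^sub>B"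
    and "entrywise_le (singular_values B) (singular_values A)"
  shows "dist_le (min CARD('m) CARD('n))
           M\<^sub>B (\<lambda>\<omega>. singular_values (residual B (G\<^sub>B \<omega>)))
           M\<^sub>A (\<lambda>\<omega>. singular_values (residual A (G\<^sub>A \<omega>)))"
  unfolding dist_le_def
proof (intro allI impI)
  fix x :: "real list" assume len: "length x = min CARD('m) CARD('n)"
  obtain V where V: "orthogonal_transformation V"
    and le: "\<And>x. norm (B *v x) \<le> norm (A *v (V x))"
    using singular_values_le_imp_norm_le[OF assms(7)] by blast
  let ?T = "\<lambda>G :: real^'l^'n. matrix V ** G"
  \<comment> \<open>Events become sets of test matrices, which brings \<open>G\<^sub>A\<close> and
    \<open>G\<^sub>B\<close>, possibly on different probability spaces, under the common law
    \<open>std_gaussian\<close>.\<close>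
  define E where "E C = {G :: real^'l^'n. entrywise_le x (singular_values (residual C G))}"
    for C :: "real^'n^'m"
  have E_sets: "E C \<in> sets borel" for C
    unfolding E_def by (rule singular_values_residual_sets[OF len])
  have T_meas: "?T \<in> borel_measurable std_gaussian"
    using orthogonal_transformation_linear[OF orthogonal_transformation_matrix_mult[OF V]]
    by (subst measurable_cong_sets[OF sets_std_gaussian refl])
       (intro borel_measurable_continuous_onI linear_continuous_on, simp add: linear_linear)
  have prob: "measure M {\<omega> \<in> space M. entrywise_le x (singular_values (residual C (G \<omega>)))}
      = measure std_gaussian (E C)"
    if "prob_space M" "std_gaussian_matrix M G" for M :: "'z measure" and G :: "'z \<Rightarrow> real^'l^'n" and C
  proof -
    have "measure (distr M borel G) (E C) = measure M (G -` E C \<inter> space M)"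
      using distr_std_gaussian_matrix(1)[OF that] E_sets by (rule measure_distr)
    moreover have "G -` E C \<inter> space M
        = {\<omega> \<in> space M. entrywise_le x (singular_values (residual C (G \<omega>)))}"
      by (auto simp: E_def)
    ultimately show ?thesis by (simp add: distr_std_gaussian_matrix(2)[OF that])
  qed
  \<comment> \<open>\<open>std_gaussian\<close> is the law of \<open>G\<^sub>A\<close>, hence a
    probability measure; monotonicity of \<open>measure\<close> relies on this finiteness.\<close>
  interpret A: prob_space "distr M\<^sub>A borel G\<^sub>A"
    using assms(3) distr_std_gaussian_matrix(1)[OF assms(3,4)] by (rule prob_space.prob_space_distr)
  have "E B \<subseteq> ?T -` E A \<inter> space std_gaussian"
  proof
    fix G assume "G \<in> E B"
    then have "entrywise_le x (singular_values (residual A (matrix V ** G)))"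
      using singular_values_residual_mono[OF V le, of G]
      by (auto simp: E_def intro: list_all2_trans[OF order_trans])
    then show "G \<in> ?T -` E A \<inter> space std_gaussian"
      by (simp add: E_def std_gaussian_def)
  qed
  then have "measure std_gaussian (E B) \<le> measure std_gaussian (?T -` E A \<inter> space std_gaussian)"
    using A.finite_measure_mono[of "E B" "?T -` E A \<inter> space std_gaussian"]
      measurable_sets[OF T_meas E_sets]
    by (simp add: distr_std_gaussian_matrix(2)[OF assms(3,4)] sets_std_gaussian)
  also have "\<dots> = measure (distr std_gaussian borel ?T) (E A)"
    using T_meas E_sets by (rule measure_distr[symmetric])
  also have "\<dots> = measure std_gaussian (E A)"
    by (simp only: distr_std_gaussian_orthogonal_transformation[OF orthogonal_transformation_matrix_mult[OF V]])
  finally show "measure M\<^sub>B {\<omega> \<in> space M\<^sub>B. entrywise_le x (singular_values (residual B (G\<^sub>B \<omega>)))}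
      \<le> measure M\<^sub>A {\<omega> \<in> space M\<^sub>A. entrywise_le x (singular_values (residual A (G\<^sub>A \<omega>)))}"
    unfolding prob[OF assms(3,4)] prob[OF assms(5,6)] .
qed

end
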